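(* For every prime number $p$ and every integer $n\ge 1$, $$B(p,n) \le \frac{p}{2p+2}\,n^2 + n\log_p n + 1.$$
   Context: Let $p$ be a prime and $n\ge 1$. Let $V$ be the natural $n$-dimensional permutation representation of the symmetric group $S_n$ over a field of characteristic $p$, and for each integer $r\ge 0$ let $\beta_{r,p}$ be the Brauer character of the symmetric power $\mathrm{Sym}^r V$, a complex-valued class function on the set of elements of $S_n$ of order coprime to $p$. Define $B(p,n)=\dim_{\mathbb{C}}\mathrm{Span}_{\mathbb{C}}\{\beta_{r,p} : r\ge 0\}$. Here $\log_p$ is the logarithm to base $p$. *)

theory Defs
  imports
    Complex_Main
    "HOL-Library.Multiset"
    "HOL-Library.Poly_Mapping"
    "HOL-Library.Function_Algebras"
    "HOL-Computational_Algebra.Polynomial"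
    "HOL-Algebra.Sym_Groups"
    "HOL-Algebra.Multiplicative_Group"
    "HOL-Algebra.Algebraic_Closure_Type"
    "Jordan_Normal_Form.Char_Poly"
begin

text \<open>The group \<open>sym_group n\<close> permutes \<open>{1..n}\<close>, whereas matrix indices start at 0, hence the
  shift by \<open>Suc\<close>: the matrix sends the basis vector \<open>e\<^sub>i\<close> to \<open>e\<^bsub>g i\<^esub>\<close>.\<close>

definition nat_perm_rep :: "nat \<Rightarrow> (nat \<Rightarrow> nat) \<Rightarrow> 'k::field mat" where
  "nat_perm_rep n g = mat n n (\<lambda>(i, j). if g (Suc j) = Suc i then 1 else 0)"

text \<open>The symmetric algebra of \<open>k\<^sup>n\<close> is the polynomial ring over \<open>k\<close> in variables
  \<open>e\<^sub>0, \<dots>, e\<^bsub>n-1\<^esub>\<close>, represented as finitely supported functions on monomials,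
  a monomial being the multiset of its variables. The list \<open>sym_basis n r\<close> enumerates the
  monomials of degree \<open>r\<close>, each written once as a weakly increasing word. The endomorphism of
  \<open>Sym\<^sup>r k\<^sup>n\<close> induced by \<open>A\<close> sends the monomial with word \<open>i\<^sub>1 \<dots> i\<^sub>r\<close> to the product
  \<open>(A e\<^bsub>i\<^sub>1\<^esub>) \<cdots> (A e\<^bsub>i\<^sub>r\<^esub>)\<close>.\<close>

definition sym_basis :: "nat \<Rightarrow> nat \<Rightarrow> nat list list" where
  "sym_basis n r = filter sorted (List.n_lists r [0..<n])"

definition linear_form :: "'k::field mat \<Rightarrow> nat \<Rightarrow> (nat multiset \<Rightarrow>\<^sub>0 'k)" where
  "linear_form A i = (\<Sum>j<dim_row A. Poly_Mapping.single {#j#} (A $$ (j, i)))"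

definition sym_power :: "nat \<Rightarrow> 'k::field mat \<Rightarrow> 'k mat" where
  "sym_power r A =
     (let bs = sym_basis (dim_row A) r
      in mat (length bs) (length bs)
           (\<lambda>(a, b). Poly_Mapping.lookup (\<Prod>i\<leftarrow>bs ! b. linear_form A i) (mset (bs ! a))))"

definition coprime_roots_of_unity :: "nat \<Rightarrow> 'a::field set" where
  "coprime_roots_of_unity p = {x. \<exists>m>0. coprime m p \<and> x ^ m = 1}"

text \<open>Brauer characters depend on the choice of an isomorphism from the group of roots of unity
  of order prime to \<open>p\<close> in an algebraic closure of \<open>k\<close> to the corresponding group in the
  complex numbers. Values of \<open>\<theta>\<close> elsewhere are irrelevant.\<close>

definition brauer_lift :: "nat \<Rightarrow> ('k::field alg_closure \<Rightarrow> complex) \<Rightarrow> bool" where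
  "brauer_lift p \<theta> \<longleftrightarrow>
     bij_betw \<theta> (coprime_roots_of_unity p) (coprime_roots_of_unity p) \<and>
     (\<forall>x\<in>coprime_roots_of_unity p. \<forall>y\<in>coprime_roots_of_unity p. \<theta> (x * y) = \<theta> x * \<theta> y)"

text \<open>The sum of the lifted eigenvalues in the algebraic closure, counted with algebraic
  multiplicity.\<close>

definition brauer_value :: "('k::field alg_closure \<Rightarrow> complex) \<Rightarrow> 'k mat \<Rightarrow> complex" where
  "brauer_value \<theta> A = (\<Sum>x\<in>#proots (char_poly (map_mat to_ac A)). \<theta> x)"

definition p_regular :: "nat \<Rightarrow> nat \<Rightarrow> (nat \<Rightarrow> nat) set" where
  "p_regular p n = {g \<in> carrier (sym_group n). coprime (group.ord (sym_group n) g) p}"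

text \<open>Functions on the set of \<open>p\<close>-regular elements are encoded as functions vanishing
  outside that set.\<close>

definition sym_brauer_char ::
  "nat \<Rightarrow> ('k::field alg_closure \<Rightarrow> complex) \<Rightarrow> nat \<Rightarrow> nat \<Rightarrow> (nat \<Rightarrow> nat) \<Rightarrow> complex" where
  "sym_brauer_char p \<theta> n r =
     (\<lambda>g. if g \<in> p_regular p n
          then brauer_value \<theta> (sym_power r (nat_perm_rep n g :: 'k mat)) else 0)"

global_interpretation cfun: vector_space "\<lambda>(c::complex) (f :: 'a \<Rightarrow> complex) x. c * f x"
  defines cfun_span = cfun.span and cfun_dim = cfun.dim
  by unfold_locales (auto simp: fun_eq_iff algebra_simps)

text \<open>All the characters are supported on the finite set \<open>p_regular p n\<close>, so the span is
  finite-dimensional and the convention \<open>dim = 0\<close> for infinite-dimensional spaces plays no role.\<close>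

definition brauer_span_dim ::
  "nat \<Rightarrow> ('k::field alg_closure \<Rightarrow> complex) \<Rightarrow> nat \<Rightarrow> nat" where
  "brauer_span_dim p \<theta> n = cfun_dim (cfun_span (range (\<lambda>r. sym_brauer_char p \<theta> n r)))"

end

(* The symmetric power of a permutation matrix is the permutation matrix of the induced action on
   monomials. Its characteristic polynomial is the product of X^l - 1 over the cycle lengths l, and
   for l > 1 coprime to p the lifted l-th roots of unity sum to 0. So the Brauer character of Sym^r
   at g counts the monomials of degree r fixed by g, and its generating function in r is the product
   of 1 / (1 - t^l) over the cycle lengths l of g.

   Write m' for the largest divisor of m coprime to p and D for the product of t^m' - 1 over
   m = 1, ..., n. Comparing multiplicities of roots of unity shows that D is a common denominator of
   these generating functions for all p-regular g. The numerators have degree deg D - n, hence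
   B(p,n) <= deg D - n + 1, and deg D = sum of m' is estimated by recursion from n to n div p. *)
theory Submission
  imports
    Defs
    "HOL-Combinatorics.Orbits"
    "HOL-Computational_Algebra.Polynomial_FPS"
begin

section \<open>Cycles of a permutation and its permutation matrix\<close>

text \<open>A common denominator separates variables: the generating function at \<open>g\<close> is
  a numerator over \<open>D\<close>, and only the numerator depends on \<open>g\<close>, so the
  number of its coefficients bounds the dimension. Every denominator has degree \<open>n\<close>,
  the sum of the cycle lengths, hence one degree bound serves all \<open>g\<close>. A root of unity
  of order d occurs in a denominator at most \<open>n div d\<close> times, and only if d is coprime
  to \<open>p\<close>; \<open>D\<close> contains it exactly \<open>n div d\<close> times, so
  \<open>D\<close> is as small as possible. The leading constant c is forced by the recursion: with
  q close to n/p the quadratic terms balance when c = 1/2 - 1/(2p) + c/p^2, that is c = p/(2p+2).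
  The term n log_p n leaves room for a linear rounding error at each of the roughly log_p n
  levels.\<close>

lemma orbit_eq_support:
  assumes "permutation f"
  shows "orbit f a = set (support f a)"
  unfolding support_set[OF assms] orbit_altdef_permutation[OF assms] by auto

lemma card_orbit:
  assumes "permutation f"
  shows "card (orbit f a) = least_power f a"
  using distinct_card[OF cycle_of_permutation[OF assms, of a]] orbit_eq_support[OF assms, of a] by simp

lemma orbit_subset_invariant:
  assumes "f ` S = S" "a \<in> S"
  shows "orbit f a \<subseteq> S"
proof
  fix x assume "x \<in> orbit f a"
  then show "x \<in> S" by induction (use assms in auto)
qed

lemma image_orbit:
  assumes "permutation f"
  shows "f ` orbit f a = orbit f a"
proof -
  have "finite (orbit f a)"
    using assms by (intro finite_orbit permutation_self_in_orbit)
  moreover have "inj_on f (orbit f a)"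
    using assms by (meson bij_is_inj inj_on_subset permutation subset_UNIV)
  ultimately show ?thesis
    by (intro endo_inj_surj) (auto intro: orbit.step)
qed

text \<open>Peeling off one orbit at a time is the scheme behind every product or sum over cycles
  below. The rest stays invariant because \<open>f\<close> is injective and maps the orbit onto
  itself.\<close>

lemma invariant_set_induct [consumes 3, case_names empty orbit]:
  assumes "permutation f" "finite S" "f ` S = S"
    and "P {}"
    and step: "\<And>S a. finite S \<Longrightarrow> f ` S = S \<Longrightarrow> a \<in> S \<Longrightarrow> orbit f a \<subseteq> S \<Longrightarrow>
      f ` (S - orbit f a) = S - orbit f a \<Longrightarrow> P (S - orbit f a) \<Longrightarrow> P S"
  shows "P S"
  using assms(2,3)
proof (induction S rule: finite_psubset_induct)
  case (psubset S)
  show ?case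
  proof (cases "S = {}")
    case True
    then show ?thesis using assms(4) by simp
  next
    case False
    then obtain a where a: "a \<in> S" by auto
    have inj: "inj f" using assms(1) by (simp add: bij_is_inj permutation)
    have sub: "orbit f a \<subseteq> S" by (rule orbit_subset_invariant[OF psubset.prems a])
    have inv: "f ` (S - orbit f a) = S - orbit f a"
      using image_set_diff[OF inj] psubset.prems image_orbit[OF assms(1), of a] by simp
    have "S - orbit f a \<subset> S"
      using a permutation_self_in_orbit[OF assms(1), of a] by auto
    then show ?thesis
      using psubset.IH inv step[OF psubset.hyps psubset.prems a sub inv] by blast
  qed
qed

section \<open>Sign of a permutation restricted to one orbit\<close>

lemma sign_cycle_of_list:
  assumes "distinct cs"
  shows "sign (cycle_of_list cs) = (- 1) ^ (length cs - 1)"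
  using assms
proof (induction cs rule: cycle_of_list.induct)
  case (1 i j cs)
  have "sign (cycle_of_list (i # j # cs)) = sign (transpose i j) * sign (cycle_of_list (j # cs))"
    by (simp add: sign_compose permutation_swap_id permutation_of_cycle)
  then show ?case using 1 by (simp add: sign_swap_id comp_def)
qed simp_all

lemma perm_restrict_orbit_eq_cycle:
  assumes "permutation f"
  shows "perm_restrict f (orbit f a) = cycle_of_list (support f a)"
  using cycle_restrict[OF assms] id_outside_supp[of _ "support f a"]
  by (auto simp: fun_eq_iff perm_restrict_def orbit_eq_support[OF assms])

lemma perm_restrict_orbit_permutes:
  assumes "permutation f"
  shows "perm_restrict f (orbit f a) permutes orbit f a"
  using cycle_permutes[of "support f a"]
  unfolding orbit_eq_support[OF assms, symmetric] perm_restrict_orbit_eq_cycle[OF assms, symmetric] .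

lemma sign_perm_restrict_orbit:
  assumes "permutation f"
  shows "sign (perm_restrict f (orbit f a)) = (- 1) ^ (card (orbit f a) - 1)"
  using sign_cycle_of_list[OF cycle_of_permutation[OF assms]]
  by (simp add: perm_restrict_orbit_eq_cycle[OF assms] card_orbit[OF assms])

text \<open>These permutations index the nonzero terms in the Leibniz expansion of the
  characteristic polynomial of the permutation matrix of \<open>f\<close>.\<close>

definition perm_selections :: "('a \<Rightarrow> 'a) \<Rightarrow> 'a set \<Rightarrow> ('a \<Rightarrow> 'a) set" where
  "perm_selections f S = {q. q permutes S \<and> (\<forall>j. q j = j \<or> q j = f j)}"

lemma perm_selectionsI:
  "q permutes S \<Longrightarrow> (\<And>j. q j = j \<or> q j = f j) \<Longrightarrow> q \<in> perm_selections f S"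
  by (simp add: perm_selections_def)

lemma perm_selectionsD:
  assumes "q \<in> perm_selections f S"
  shows "q permutes S" "\<forall>j. q j = j \<or> q j = f j"
  using assms by (simp_all add: perm_selections_def)

text \<open>Being moved propagates along \<open>f\<close>: if \<open>q y = f y\<close> differs from
  \<open>y\<close>, then injectivity forbids \<open>q (f y) = f y\<close>. Following the orbit from
  a moved \<open>x\<close> back to \<open>a\<close> would show that \<open>a\<close> is
  moved.\<close>

lemma perm_selection_fixed_orbit:
  assumes f: "permutation f" and q: "inj q" "\<forall>j. q j = j \<or> q j = f j"
    and x: "x \<in> orbit f a" and "q a = a"
  shows "q x = x"
proof (rule ccontr)
  assume neq: "q x \<noteq> x"
  have self: "a \<in> orbit f a" by (rule permutation_self_in_orbit[OF f])
  have a: "a \<in> orbit f x" by (rule orbit_swap[OF self x])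
  have step: "q (f y) \<noteq> f y" if "q y \<noteq> y" for y
    using that q(2)[rule_format, of y] injD[OF q(1), of y "f y"] by metis
  from a have "q a \<noteq> a"
    by induction (use neq step in auto)
  with assms show False by simp
qed

lemma perm_selection_moved_orbit:
  assumes f: "permutation f" and q: "inj q" "\<forall>j. q j = j \<or> q j = f j"
    and x: "x \<in> orbit f a" and "q a \<noteq> a"
  shows "q x = f x"
proof -
  have self: "a \<in> orbit f a" by (rule permutation_self_in_orbit[OF f])
  have "q x \<noteq> x"
    using perm_selection_fixed_orbit[OF f q orbit_swap[OF self x]] assms(5) by blast
  then show ?thesis using q(2) by blast
qed

text \<open>On the orbit of \<open>a\<close> the choice is all or nothing: identity or
  \<open>f\<close>. The choice on the remaining points is independent of it. If
  \<open>f a = a\<close> the two options coincide, hence the extra premise of the second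
  part.\<close>

lemma perm_selections_split:
  assumes f: "permutation f" and S: "finite S" "f ` S = S" "a \<in> S"
  defines "C \<equiv> orbit f a"
  shows "{q \<in> perm_selections f S. q a = a} = perm_selections f (S - C)" (is ?A)
    and "f a \<noteq> a \<Longrightarrow> {q \<in> perm_selections f S. q a \<noteq> a}
           = (\<lambda>q. q \<circ> perm_restrict f C) ` perm_selections f (S - C)" (is "_ \<Longrightarrow> ?B")
proof -
  have sub: "C \<subseteq> S" unfolding C_def by (rule orbit_subset_invariant[OF S(2,3)])
  have aC: "a \<in> C" unfolding C_def by (rule permutation_self_in_orbit[OF f])
  have cC: "perm_restrict f C permutes C"
    unfolding C_def by (rule perm_restrict_orbit_permutes[OF f])
  have fC: "f x \<in> C" if "x \<in> C" for x using that unfolding C_def by (rule orbit.step)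
  show ?A
  proof (intro equalityI subsetI)
    fix q assume "q \<in> {q \<in> perm_selections f S. q a = a}"
    then have q: "q permutes S" "\<forall>j. q j = j \<or> q j = f j" "q a = a"
      by (simp_all add: perm_selections_def)
    have "q x = x" if "x \<in> C" for x
      using perm_selection_fixed_orbit[OF f permutes_inj[OF q(1)] q(2) _ q(3)] that
      unfolding C_def by blast
    then have "q permutes (S - C)"
      by (intro permutes_superset[OF q(1)]) auto
    then show "q \<in> perm_selections f (S - C)" using q(2) by (blast intro: perm_selectionsI)
  next
    fix q assume "q \<in> perm_selections f (S - C)"
    note q = perm_selectionsD[OF this]
    have "q permutes S" by (rule permutes_subset[OF q(1)]) simp
    moreover have "q a = a" using aC by (intro permutes_not_in[OF q(1)]) simp
    ultimately show "q \<in> {q \<in> perm_selections f S. q a = a}"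
      using q(2) by (simp add: perm_selections_def)
  qed
  assume ne: "f a \<noteq> a"
  show ?B
  proof (intro equalityI subsetI)
    fix q assume "q \<in> {q \<in> perm_selections f S. q a \<noteq> a}"
    then have q: "q permutes S" "\<forall>j. q j = j \<or> q j = f j" "q a \<noteq> a"
      by (simp_all add: perm_selections_def)
    have qC: "q x = f x" if "x \<in> C" for x
      using perm_selection_moved_orbit[OF f permutes_inj[OF q(1)] q(2) _ q(3)] that
      unfolding C_def by blast
    \<comment> \<open>Undoing the cycle on \<open>C\<close> yields a permutation that fixes
      \<open>C\<close> pointwise and agrees with \<open>q\<close> elsewhere.\<close>
    define r where "r = q \<circ> inv_into UNIV (perm_restrict f C)"
    have rq: "q = r \<circ> perm_restrict f C"
      using permutes_inv_o(2)[OF cC] by (simp add: r_def comp_assoc)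
    have rS: "r permutes S"
      unfolding r_def by (intro permutes_compose permutes_subset[OF permutes_inv[OF cC] sub] q(1))
    have rC: "r x = x" if "x \<in> C" for x
    proof -
      have "x \<in> perm_restrict f C ` C" using that permutes_image[OF cC] by simp
      then obtain y where y: "y \<in> C" "x = perm_restrict f C y" by auto
      then have "r x = q y" by (simp add: rq)
      also have "\<dots> = x" using y qC by (simp add: perm_restrict_def)
      finally show ?thesis .
    qed
    have "r permutes (S - C)" by (intro permutes_superset[OF rS]) (use rC in auto)
    moreover have "r j = j \<or> r j = f j" for j
    proof (cases "j \<in> C")
      case False
      then have "q j = r j" by (simp add: rq perm_restrict_def)
      then show ?thesis using q(2) by metis
    qed (simp add: rC)
    ultimately have "r \<in> perm_selections f (S - C)" by (rule perm_selectionsI)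
    then show "q \<in> (\<lambda>q. q \<circ> perm_restrict f C) ` perm_selections f (S - C)"
      unfolding rq by (rule imageI)
  next
    fix q assume "q \<in> (\<lambda>q. q \<circ> perm_restrict f C) ` perm_selections f (S - C)"
    then obtain r where "r \<in> perm_selections f (S - C)" and q: "q = r \<circ> perm_restrict f C"
      by (rule imageE)
    note r = perm_selectionsD[OF this(1)]
    have rC: "r x = x" if "x \<in> C" for x using that by (intro permutes_not_in[OF r(1)]) simp
    have "q permutes S"
      unfolding q by (intro permutes_compose permutes_subset[OF cC sub] permutes_subset[OF r(1)]) auto
    moreover have "q j = j \<or> q j = f j" for j
      using r(2) rC fC by (simp add: q perm_restrict_def)
    moreover have "q a \<noteq> a" using ne aC rC fC by (simp add: q perm_restrict_def)
    ultimately show "q \<in> {q \<in> perm_selections f S. q a \<noteq> a}" by (simp add: perm_selections_def)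
  qed
qed


section \<open>Cycle type of a permutation on an invariant set\<close>

definition cycle_lengths :: "('a \<Rightarrow> 'a) \<Rightarrow> 'a set \<Rightarrow> nat multiset" where
  "cycle_lengths f S = image_mset card (mset_set (orbit f ` S))"

lemma cycle_lengths_empty [simp]: "cycle_lengths f {} = {#}"
  by (simp add: cycle_lengths_def)

lemma cycle_lengths_remove_orbit:
  assumes f: "permutation f" and S: "finite S" "f ` S = S" "a \<in> S"
  shows "cycle_lengths f S = add_mset (card (orbit f a)) (cycle_lengths f (S - orbit f a))"
proof -
  have self: "x \<in> orbit f x" for x by (rule permutation_self_in_orbit[OF f])
  have eq: "orbit f x = orbit f a" if "x \<in> orbit f a" for x
    using orbit_trans[OF _ that] orbit_trans[OF _ orbit_swap[OF self that]] by blast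
  have sub: "orbit f a \<subseteq> S" by (rule orbit_subset_invariant[OF S(2,3)])
  have "orbit f ` S = insert (orbit f a) (orbit f ` (S - orbit f a))"
    using eq S(3) by auto
  moreover have "orbit f a \<notin> orbit f ` (S - orbit f a)"
    using self by auto
  ultimately show ?thesis
    using S(1) by (simp add: cycle_lengths_def)
qed

lemma in_cycle_lengths:
  assumes "l \<in># cycle_lengths f S"
  obtains a where "a \<in> S" "l = card (orbit f a)"
proof -
  \<comment> \<open>\<open>mset_set\<close> of an infinite set is empty, so the existence of an
    element already forces finiteness.\<close>
  from assms have "finite (orbit f ` S)"
    by (metis cycle_lengths_def empty_iff image_mset_empty mset_set.infinite set_mset_empty)
  then show ?thesis using assms that by (auto simp: cycle_lengths_def)
qed

lemma sum_cycle_lengths: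
  assumes "permutation f" "finite S" "f ` S = S"
  shows "sum_mset (cycle_lengths f S) = card S"
  using assms
proof (induction S rule: invariant_set_induct)
  case (orbit S a)
  then show ?case
    using card_Diff_subset[of "orbit f a" S] card_mono[of S "orbit f a"] finite_subset[of "orbit f a" S]
    by (simp add: cycle_lengths_remove_orbit[OF assms(1) orbit(1-3)])
qed simp

lemma count_1_cycle_lengths:
  assumes "permutation f" "finite S" "f ` S = S"
  shows "count (cycle_lengths f S) 1 = card {x \<in> S. f x = x}"
  using assms
proof (induction S rule: invariant_set_induct)
  case (orbit S a)
  have self: "x \<in> orbit f x" for x by (rule permutation_self_in_orbit[OF assms(1)])
  note rec = cycle_lengths_remove_orbit[OF assms(1) orbit(1-3)]
  show ?case
  proof (cases "f a = a")
    case True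
    then have C: "orbit f a = {a}" by (simp add: orbit_eq_singleton_iff)
    have "{x \<in> S. f x = x} = insert a {x \<in> S - {a}. f x = x}" using True orbit(3) by auto
    then show ?thesis using orbit(1,6) rec by (simp add: C)
  next
    case False
    have "f x \<noteq> x" if "x \<in> orbit f a" for x
    proof
      assume "f x = x"
      then have "orbit f x = {x}" by (simp add: orbit_eq_singleton_iff)
      with orbit_swap[OF self that] have "a = x" by auto
      with False \<open>f x = x\<close> show False by simp
    qed
    then have "{x \<in> S. f x = x} = {x \<in> S - orbit f a. f x = x}" by auto
    moreover have "card (orbit f a) \<noteq> 1"
      using False orbit_eq_singleton_iff[of f a] self[of a] by (auto simp: card_1_singleton_iff)
    ultimately show ?thesis using orbit(6) rec by simp
  qed
qed simp

section \<open>Leibniz expansion of the characteristic polynomial\<close>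

lemma finite_perm_selections: "finite S \<Longrightarrow> finite (perm_selections f S)"
  unfolding perm_selections_def using finite_permutations[of S] by (rule rev_finite_subset) auto

text \<open>Here \<open>w\<close> is the matrix of x minus the permutation. An orbit of length l > 1
  contributes x^l from the diagonal if it is left fixed; if it is rotated, l entries -1 and the sign
  (-1)^(l-1) of the cycle contribute -1. A fixed point has a single option, with entry x -
  1.\<close>

lemma sum_perm_selections:
  fixes f :: "'a \<Rightarrow> 'a" and x :: "'b::comm_ring_1"
  assumes f: "permutation f" and "finite S" "f ` S = S"
  defines "w \<equiv> \<lambda>i j. (if i = j then x else 0) - (if f j = i then 1 else 0)"
  shows "(\<Sum>q\<in>perm_selections f S. of_int (sign q) * (\<Prod>j\<in>S. w (q j) j))
    = (\<Prod>l\<in>#cycle_lengths f S. x ^ l - 1)"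
  using assms(1-3)
proof (induction S rule: invariant_set_induct)
  case empty
  have "perm_selections f {} = {id}" by (auto simp: perm_selections_def)
  then show ?case by simp
next
  case (orbit S a)
  note rec = cycle_lengths_remove_orbit[OF f orbit(1-3)]
  note split = perm_selections_split[OF f orbit(1-3)]
  define C where "C = orbit f a"
  have aC: "a \<in> C" unfolding C_def by (rule permutation_self_in_orbit[OF f])
  have finC: "finite C" using orbit(1,4) finite_subset by (auto simp: C_def)
  have prod_split: "(\<Prod>j\<in>S. g j) = (\<Prod>j\<in>C. g j) * (\<Prod>j\<in>S - C. g j)" for g :: "'a \<Rightarrow> 'b"
    using prod.subset_diff[of C S g] orbit(1,4) by (simp add: C_def mult.commute)
  let ?F = "\<lambda>S q. of_int (sign q) * (\<Prod>j\<in>S. w (q j) j)"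
  have fixC: "q j = j" if "q \<in> perm_selections f (S - C)" "j \<in> C" for q j
    using that(2) by (intro permutes_not_in[OF perm_selectionsD(1)[OF that(1)]]) simp
  have fin: "finite (perm_selections f S)" by (rule finite_perm_selections[OF orbit(1)])
  show ?case
  proof (cases "f a = a")
    case True
    then have C: "C = {a}" by (simp add: orbit_eq_singleton_iff C_def)
    have "q a = a" if "q \<in> perm_selections f S" for q
      using perm_selectionsD(2)[OF that] True by metis
    then have "perm_selections f S = perm_selections f (S - C)"
      using split(1) by (auto simp: C_def)
    moreover have "?F S q = (x - 1) * ?F (S - C) q" if "q \<in> perm_selections f (S - C)" for q
      using fixC[OF that, of a] True by (simp add: prod_split C w_def)
    ultimately have "sum (?F S) (perm_selections f S) = (x - 1) * sum (?F (S - C)) (perm_selections f (S - C))"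
      by (simp add: sum_distrib_left)
    then show ?thesis using orbit(6) rec by (simp flip: C_def) (simp add: C)
  next
    case False
    define c where "c = perm_restrict f C"
    have moved: "f j \<noteq> j" if "j \<in> C" for j
    proof
      assume "f j = j"
      then have "orbit f j = {j}" by (simp add: orbit_eq_singleton_iff)
      moreover have "a \<in> orbit f j"
        using that orbit_swap[OF permutation_self_in_orbit[OF f]] unfolding C_def by blast
      ultimately show False using \<open>f j = j\<close> False by auto
    qed
    have fC: "f j \<in> C" if "j \<in> C" for j using that unfolding C_def by (rule orbit.step)
    have sgn: "sign c = (- 1) ^ (card C - 1)"
      unfolding c_def C_def by (rule sign_perm_restrict_orbit[OF f])
    have c: "c permutes C"
      unfolding c_def C_def by (rule perm_restrict_orbit_permutes[OF f])
    have A: "?F S q = x ^ card C * ?F (S - C) q" if q: "q \<in> perm_selections f (S - C)" for q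
    proof -
      have "(\<Prod>j\<in>C. w (q j) j) = (\<Prod>j\<in>C. x)"
        by (rule prod.cong) (auto simp: fixC[OF q] w_def moved)
      then show ?thesis by (simp add: prod_split)
    qed
    have B: "?F S (q \<circ> c) = - ?F (S - C) q" if q: "q \<in> perm_selections f (S - C)" for q
    proof -
      have 1: "(\<Prod>j\<in>C. w ((q \<circ> c) j) j) = (\<Prod>j\<in>C. - 1)"
        by (rule prod.cong) (auto simp: fixC[OF q] fC w_def moved c_def perm_restrict_def)
      have 2: "(\<Prod>j\<in>S - C. w ((q \<circ> c) j) j) = (\<Prod>j\<in>S - C. w (q j) j)"
        by (rule prod.cong) (auto simp: c_def perm_restrict_def)
      have "permutation q"
        using orbit(1) by (intro permutes_imp_permutation[OF _ perm_selectionsD(1)[OF q]]) simp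
      moreover have "permutation c" by (rule permutes_imp_permutation[OF finC c])
      ultimately have 3: "sign (q \<circ> c) = sign q * (- 1) ^ (card C - 1)"
        by (simp add: sign_compose sgn)
      \<comment> \<open>With truncated subtraction the exponents \<open>card C - 1\<close> and
        \<open>card C\<close> have opposite parity only for nonempty \<open>C\<close>.\<close>
      have "card C > 0" using aC finC card_gt_0_iff by blast
      then have "(- 1 :: 'b) ^ (card C - 1) * (- 1) ^ card C = - 1"
        by (cases "card C") (simp_all flip: power_mult_distrib)
      then show ?thesis
        unfolding prod_split 1 2 3 by (simp add: ac_simps) (simp add: mult.assoc[symmetric])
    qed
    have inj: "inj_on (\<lambda>q. q \<circ> c) (perm_selections f (S - C))"
    proof (rule inj_onI)
      fix q r assume "q \<circ> c = r \<circ> c"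
      then have "(q \<circ> c) \<circ> inv_into UNIV c = (r \<circ> c) \<circ> inv_into UNIV c" by simp
      then show "q = r" by (simp add: comp_assoc permutes_inv_o[OF c])
    qed
    have un: "perm_selections f S = {q \<in> perm_selections f S. q a = a} \<union> {q \<in> perm_selections f S. q a \<noteq> a}"
      by auto
    have "sum (?F S) (perm_selections f S)
        = sum (?F S) {q \<in> perm_selections f S. q a = a} + sum (?F S) {q \<in> perm_selections f S. q a \<noteq> a}"
      by (subst un, rule sum.union_disjoint) (use fin in auto)
    also have "\<dots> = sum (?F S) (perm_selections f (S - C)) + sum (?F S \<circ> (\<lambda>q. q \<circ> c)) (perm_selections f (S - C))"
      unfolding split(1) split(2)[OF False] C_def[symmetric] c_def[symmetric]
      by (subst sum.reindex[OF inj]) simp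
    also have "\<dots> = (x ^ card C - 1) * sum (?F (S - C)) (perm_selections f (S - C))"
      using A B by (simp add: sum_distrib_left left_diff_distrib sum_subtractf sum_negf)
    finally show ?thesis using orbit(6) rec by (simp flip: C_def)
  qed
qed

text \<open>In column \<open>j\<close> the characteristic matrix vanishes outside the rows
  \<open>j\<close> and \<open>f j\<close>, so only selections survive in the determinant. The
  expansion is valid over every commutative ring, so characteristic \<open>p\<close> causes no
  difficulty.\<close>

lemma char_poly_permutation_matrix:
  assumes "f permutes {..<n}"
  shows "char_poly (mat n n (\<lambda>(i, j). if f j = i then 1 else 0) :: 'a::comm_ring_1 mat)
    = (\<Prod>l\<in>#cycle_lengths f {..<n}. monom 1 l - 1)"
proof -
  let ?A = "mat n n (\<lambda>(i, j). if f j = i then 1 else 0) :: 'a mat"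
  define w :: "nat \<Rightarrow> nat \<Rightarrow> 'a poly"
    where "w = (\<lambda>i j. (if i = j then monom 1 1 else 0) - (if f j = i then 1 else 0))"
  have f: "permutation f" by (rule permutes_imp_permutation[OF _ assms]) simp
  have entry: "char_poly_matrix ?A $$ (i, j) = w i j" if "i < n" "j < n" for i j
    using that by (auto simp: char_poly_matrix_def w_def monom_altdef one_pCons)
  have "char_poly ?A = (\<Sum>q | q permutes {..<n}. of_int (sign q) * (\<Prod>j<n. w (q j) j))"
    unfolding char_poly_def
  proof (subst det_col[where n = n])
    show "char_poly_matrix ?A \<in> carrier_mat n n" by simp
    show "(\<Sum>p | p permutes {0..<n}. of_int (sign p) * (\<Prod>j<n. char_poly_matrix ?A $$ (p j, j)))
      = (\<Sum>q | q permutes {..<n}. of_int (sign q) * (\<Prod>j<n. w (q j) j))"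
      unfolding atLeast0LessThan
    proof (intro sum.cong refl, goal_cases)
      case (1 q)
      then have "q j < n" if "j < n" for j using that permutes_in_image[of q "{..<n}" j] by auto
      then show ?case using entry by simp
    qed
  qed
  also have "\<dots> = (\<Sum>q\<in>perm_selections f {..<n}. of_int (sign q) * (\<Prod>j<n. w (q j) j))"
  proof (rule sum.mono_neutral_right)
    show "\<forall>q\<in>{q. q permutes {..<n}} - perm_selections f {..<n}.
      of_int (sign q) * (\<Prod>j<n. w (q j) j) = 0"
    proof
      fix q assume "q \<in> {q. q permutes {..<n}} - perm_selections f {..<n}"
      then obtain j where q: "q permutes {..<n}" and j: "q j \<noteq> j" "q j \<noteq> f j"
        by (auto simp: perm_selections_def)
      then have "j < n" using permutes_not_in[OF q, of j] by auto
      moreover have "w (q j) j = 0" using j by (simp add: w_def)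
      ultimately have "(\<Prod>j<n. w (q j) j) = 0" by (intro prod_zero) auto
      then show "of_int (sign q) * (\<Prod>j<n. w (q j) j) = 0" by simp
    qed
  qed (auto simp: perm_selections_def finite_permutations)
  also have "\<dots> = (\<Prod>l\<in>#cycle_lengths f {..<n}. monom 1 1 ^ l - 1)"
    unfolding w_def using permutes_image[OF assms] by (intro sum_perm_selections f) simp_all
  finally show ?thesis by (simp add: monom_power)
qed

section \<open>Lifting roots of unity\<close>

lemma monom_minus_1_neq_0:
  assumes "l > 0"
  shows "monom 1 l - 1 \<noteq> (0 :: 'a::comm_ring_1 poly)"
proof
  assume "monom 1 l - 1 = (0 :: 'a poly)"
  then have "coeff (monom 1 l - 1 :: 'a poly) l = coeff 0 l" by (rule arg_cong)
  then show False using assms by simp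
qed

text \<open>The derivative l z^(l-1) is nonzero at a root z, since l is invertible in the field;
  hence every root is simple.\<close>

lemma order_monom_minus_1:
  fixes z :: "'a::field"
  assumes "of_nat l \<noteq> (0 :: 'a)"
  shows "order z (monom 1 l - 1) = (if z ^ l = 1 then 1 else 0)"
proof -
  have "l > 0" using assms by (cases l) auto
  have poly: "poly (monom 1 l - 1) z = z ^ l - 1" by (simp add: poly_monom)
  from \<open>l > 0\<close> have nz: "monom 1 l - 1 \<noteq> (0 :: 'a poly)" by (rule monom_minus_1_neq_0)
  show ?thesis
  proof (cases "z ^ l = 1")
    case True
    then have "z \<noteq> 0" using \<open>l > 0\<close> by (auto simp: power_0_left)
    have pd: "pderiv (monom 1 l - 1 :: 'a poly) = monom (of_nat l) (l - 1)"
      by (simp add: pderiv_diff pderiv_monom)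
    have "poly (monom 1 l - 1) z = 0" unfolding poly using True by simp
    then have "order z (monom 1 l - 1) \<noteq> 0" using nz unfolding order_root by blast
    moreover have "\<not> order z (monom 1 l - 1) \<ge> 2"
    proof
      assume "order z (monom 1 l - 1) \<ge> 2"
      then have "[:-z, 1:] ^ 2 dvd (monom 1 l - 1)" by (simp add: order_divides)
      then obtain q where "monom 1 l - 1 = [:-z, 1:] ^ 2 * q" by (rule dvdE)
      then have "monom 1 l - 1 = [:-z, 1:] * ([:-z, 1:] * q)"
        by (simp only: power2_eq_square mult.assoc)
      then have "poly (pderiv (monom 1 l - 1)) z = 0"
        by (simp add: pderiv_mult del: mult_pCons_left)
      then show False using assms \<open>z \<noteq> 0\<close> by (simp add: pd poly_monom)
    qed
    ultimately show ?thesis using True by simp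
  next
    case False
    then show ?thesis using poly by (simp add: order_0I)
  qed
qed

lemma proots_monom_minus_1:
  assumes "of_nat l \<noteq> (0 :: 'a::field)"
  shows "proots (monom 1 l - 1) = mset_set {z :: 'a::field. z ^ l = 1}"
    and "finite {z :: 'a::field. z ^ l = 1}"
proof -
  have "l > 0" using assms by (cases l) auto
  from \<open>l > 0\<close> have nz: "monom 1 l - 1 \<noteq> (0 :: 'a poly)" by (rule monom_minus_1_neq_0)
  have "{z :: 'a. z ^ l = 1} = {z. poly (monom 1 l - 1) z = 0}" by (simp add: poly_monom)
  then show fin: "finite {z :: 'a. z ^ l = 1}" using poly_roots_finite[OF nz] by simp
  show "proots (monom 1 l - 1) = mset_set {z :: 'a. z ^ l = 1}"
    by (rule multiset_eqI) (use nz fin assms in \<open>auto simp: order_monom_minus_1\<close>)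
qed

text \<open>As 1 is a simple root, dividing it out leaves a cofactor of positive degree l - 1 that
  does not vanish at 1; any root of the cofactor serves.\<close>

lemma exists_nontrivial_root_of_unity:
  assumes "of_nat l \<noteq> (0 :: 'a::alg_closed_field)" "l \<noteq> 1"
  obtains z :: "'a::alg_closed_field" where "z ^ l = 1" "z \<noteq> 1"
proof -
  have "l > 0" using assms by (cases l) auto
  have "order 1 (monom 1 l - 1 :: 'a poly) = 1" by (simp add: order_monom_minus_1[OF assms(1)])
  moreover have nz: "monom 1 l - 1 \<noteq> (0 :: 'a poly)"
    using \<open>l > 0\<close> by (rule monom_minus_1_neq_0)
  ultimately obtain q :: "'a poly" where q: "monom 1 l - 1 = [:-1, 1:] * q" "\<not> [:-1, 1:] dvd q"
    using order_decomp[of "monom 1 l - 1" "1 :: 'a"] by auto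
  have "degree (monom 1 l - 1 :: 'a poly) = l" using \<open>l > 0\<close>
    by (intro antisym degree_le le_degree) (auto simp: coeff_eq_0)
  moreover have "q \<noteq> 0" using nz q by auto
  ultimately have "degree q = l - 1" using q(1) by (simp add: degree_mult_eq del: mult_pCons_left)
  then have "degree q > 0" using assms(2) \<open>l > 0\<close> by simp
  then obtain z where z: "poly q z = 0" using alg_closed_imp_poly_has_root by blast
  then have "poly (monom 1 l - 1) z = 0" by (simp add: q(1) del: mult_pCons_left)
  then have "z ^ l = 1" by (simp add: poly_monom)
  moreover have "z \<noteq> 1" using z q(2) by (auto simp: poly_eq_0_iff_dvd)
  ultimately show ?thesis using that by blast
qed

text \<open>Multiplication by a root \<open>y\<close> other than 1 permutes the summands and scales
  the sum by \<open>\<theta> y\<close>, which is not 1 by injectivity; so the sum vanishes. The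
  result is the same for every choice of lift.\<close>

lemma sum_brauer_lift_roots_of_unity:
  fixes \<theta> :: "'k::field alg_closure \<Rightarrow> complex"
  assumes p: "prime p" "CHAR('k) = p" and \<theta>: "brauer_lift p \<theta>" and l: "coprime l p"
  shows "(\<Sum>x\<in>#proots (monom 1 l - 1). \<theta> x) = (if l = 1 then 1 else 0)"
proof -
  have "l > 0" using l p(1) by (cases l) auto
  have "\<not> p dvd l" using l p(1) by (metis coprime_absorb_right coprime_commute not_prime_unit)
  then have l0: "of_nat l \<noteq> (0 :: 'k alg_closure)"
    using p(2) by (simp add: of_nat_eq_0_iff_char_dvd)
  let ?R = "{z :: 'k alg_closure. z ^ l = 1}"
  have R: "?R \<subseteq> coprime_roots_of_unity p"
    using \<open>l > 0\<close> l by (auto simp: coprime_roots_of_unity_def)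
  have inj: "inj_on \<theta> (coprime_roots_of_unity p)"
    using \<theta> by (simp add: brauer_lift_def bij_betw_def)
  have mem: "\<theta> x \<in> coprime_roots_of_unity p" if "x \<in> coprime_roots_of_unity p" for x
    using \<theta> that by (auto simp: brauer_lift_def bij_betw_def)
  have mult: "\<theta> (x * y) = \<theta> x * \<theta> y" if "x \<in> ?R" "y \<in> ?R" for x y
    using \<theta> R that by (auto simp: brauer_lift_def)
  have one: "1 \<in> ?R" by simp
  \<comment> \<open>Multiplicativity only makes \<open>\<theta> 1\<close> idempotent; being a root
    of unity excludes the value 0.\<close>
  have "\<theta> 1 \<noteq> 0"
  proof -
    have "(1 :: 'k alg_closure) \<in> coprime_roots_of_unity p" using R one by (rule subsetD)
    then have "\<theta> 1 \<in> coprime_roots_of_unity p" by (rule mem)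
    then obtain k where "k > 0" "\<theta> 1 ^ k = 1" by (auto simp: coprime_roots_of_unity_def)
    then show ?thesis by (auto simp: power_0_left)
  qed
  then have \<theta>1: "\<theta> 1 = 1" using mult[OF one one] by simp
  have eq: "(\<Sum>x\<in>#proots (monom 1 l - 1). \<theta> x) = (\<Sum>x\<in>?R. \<theta> x)"
    by (simp add: proots_monom_minus_1[OF l0] sum_unfold_sum_mset)
  show ?thesis
  proof (cases "l = 1")
    case True
    then show ?thesis using eq \<theta>1 by simp
  next
    case False
    obtain y :: "'k alg_closure" where y: "y ^ l = 1" "y \<noteq> 1"
      using exists_nontrivial_root_of_unity[OF l0 False] by blast
    have "y \<noteq> 0" using y \<open>l > 0\<close> by (auto simp: power_0_left)
    have "bij_betw ((*) y) ?R ?R"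
      by (rule bij_betw_byWitness[where f' = "\<lambda>x. x / y"])
        (use y \<open>y \<noteq> 0\<close> in \<open>auto simp: power_mult_distrib power_divide\<close>)
    then have "(\<Sum>x\<in>?R. \<theta> x) = (\<Sum>x\<in>?R. \<theta> (y * x))"
      by (rule sum.reindex_bij_betw[symmetric])
    also have "\<dots> = \<theta> y * (\<Sum>x\<in>?R. \<theta> x)"
      unfolding sum_distrib_left using y by (intro sum.cong refl mult) auto
    finally have "(1 - \<theta> y) * (\<Sum>x\<in>?R. \<theta> x) = 0" by (simp add: algebra_simps)
    moreover have "\<theta> y \<noteq> 1"
    proof
      assume "\<theta> y = 1"
      then have "\<theta> y = \<theta> 1" using \<theta>1 by simp
      moreover have "y \<in> ?R" using y by simp
      ultimately have "y = 1" using inj_onD[OF inj] one R by blast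
      with y show False by simp
    qed
    ultimately show ?thesis using eq False by simp
  qed
qed

lemma sum_mset_proots_prod_mset:
  fixes g :: "'b \<Rightarrow> 'a::idom poly"
  assumes "\<And>l. l \<in># M \<Longrightarrow> g l \<noteq> 0"
  shows "(\<Sum>x\<in>#proots (\<Prod>l\<in>#M. g l). h x) = (\<Sum>l\<in>#M. \<Sum>x\<in>#proots (g l). h x)"
  using assms
proof (induction M)
  case (add l M)
  have "(\<Prod>l\<in>#M. g l) \<noteq> 0" using add.prems by auto
  then show ?case using add by (simp add: proots_mult)
qed simp

lemma sum_mset_of_bool: "(\<Sum>l\<in>#M. if l = a then 1 else 0) = of_nat (count M a)"
  by (induction M) auto

lemma coprime_cycle_length:
  assumes f: "permutation f" and m: "f ^^ m = id" "coprime m p" and l: "l \<in># cycle_lengths f S"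
  shows "coprime l p"
proof -
  from l obtain a where "l = card (orbit f a)" by (rule in_cycle_lengths)
  then have "l dvd m" using m(1) by (simp add: card_orbit[OF f] least_power_minimal)
  then show ?thesis using m(2) coprime_divisors[of l m p p] by simp
qed

lemma brauer_value_permutation_matrix:
  fixes \<theta> :: "'k::field alg_closure \<Rightarrow> complex"
  assumes p: "prime p" "CHAR('k) = p" and \<theta>: "brauer_lift p \<theta>"
    and f: "f permutes {..<n}" and m: "f ^^ m = id" "coprime m p"
  shows "brauer_value \<theta> (mat n n (\<lambda>(i, j). if f j = i then 1 else 0) :: 'k mat)
    = of_nat (card {i. i < n \<and> f i = i})"
proof -
  have perm: "permutation f" by (rule permutes_imp_permutation[OF _ f]) simp
  note cop = coprime_cycle_length[OF perm m]
  have nz: "monom 1 l - 1 \<noteq> (0 :: 'k alg_closure poly)" if "l \<in># cycle_lengths f {..<n}" for l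
  proof -
    have "l > 0" using cop[OF that] p(1) by (cases l) auto
    then show ?thesis by (rule monom_minus_1_neq_0)
  qed
  have "map_mat to_ac (mat n n (\<lambda>(i, j). if f j = i then 1 else 0) :: 'k mat)
      = mat n n (\<lambda>(i, j). if f j = i then 1 else 0)"
    by (rule eq_matI) auto
  then have "brauer_value \<theta> (mat n n (\<lambda>(i, j). if f j = i then 1 else 0) :: 'k mat)
      = (\<Sum>x\<in>#proots (\<Prod>l\<in>#cycle_lengths f {..<n}. monom 1 l - 1). \<theta> x)"
    by (simp add: brauer_value_def char_poly_permutation_matrix[OF f])
  also have "\<dots> = (\<Sum>l\<in>#cycle_lengths f {..<n}. \<Sum>x\<in>#proots (monom 1 l - 1). \<theta> x)"
    by (rule sum_mset_proots_prod_mset) (use nz in blast)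
  also have "\<dots> = (\<Sum>l\<in>#cycle_lengths f {..<n}. if l = 1 then 1 else 0)"
    using sum_brauer_lift_roots_of_unity[OF p \<theta> cop] by (intro arg_cong[of _ _ sum_mset] image_mset_cong) 
  also have "\<dots> = of_nat (count (cycle_lengths f {..<n}) 1)"
    by (rule sum_mset_of_bool)
  also have "\<dots> = of_nat (card {i. i < n \<and> f i = i})"
    using count_1_cycle_lengths[OF perm _ permutes_image[OF f]] by (simp add: conj_commute)
  finally show ?thesis .
qed

section \<open>Symmetric powers of permutation matrices\<close>

text \<open>Turns the action on monomials into a permutation of matrix indices, so that the
  fixed-point formula for permutation matrices also covers symmetric powers.\<close>

lemma transport_permutation:
  fixes e :: "nat \<Rightarrow> 'a"
  assumes e: "bij_betw e {..<N} M" and H: "bij_betw H M M"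
  obtains s where "s permutes {..<N}" "\<And>b. b < N \<Longrightarrow> e (s b) = H (e b)"
proof -
  define s where "s = (\<lambda>b. if b < N then inv_into {..<N} e (H (e b)) else b)"
  have inv: "bij_betw (inv_into {..<N} e) M {..<N}" by (rule bij_betw_inv_into[OF e])
  have "bij_betw (inv_into {..<N} e \<circ> (H \<circ> e)) {..<N} {..<N}"
    by (intro bij_betw_trans[OF bij_betw_trans[OF e H] inv])
  then have "bij_betw s {..<N} {..<N}"
    by (subst bij_betw_cong[where g = "inv_into {..<N} e \<circ> (H \<circ> e)"]) (auto simp: s_def)
  then have "s permutes {..<N}" by (rule bij_imp_permutes) (simp add: s_def)
  moreover have "e (s b) = H (e b)" if "b < N" for b
    using that bij_betw_inv_into_right[OF e] bij_betwE[OF e] bij_betwE[OF H] by (simp add: s_def)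
  ultimately show ?thesis by (rule that)
qed

lemma funpow_image_mset:
  fixes h :: "'a \<Rightarrow> 'a"
  shows "(image_mset h ^^ m) M = image_mset (h ^^ m) M"
  by (induction m) (simp_all add: multiset.map_comp comp_def)

lemma bij_betw_mset_sym_basis:
  "bij_betw (\<lambda>b. mset (sym_basis n r ! b)) {..<length (sym_basis n r)} (multisets_of_size {..<n} r)"
proof -
  have dist: "distinct (sym_basis n r)"
    by (simp add: sym_basis_def distinct_n_lists)
  have set: "set (sym_basis n r) = {w. sorted w \<and> length w = r \<and> set w \<subseteq> {..<n}}"
    by (auto simp: sym_basis_def set_n_lists)
  have "bij_betw ((!) (sym_basis n r)) {..<length (sym_basis n r)} (set (sym_basis n r))"
    using dist by (rule bij_betw_nth) simp_all
  moreover have "bij_betw mset (set (sym_basis n r)) (multisets_of_size {..<n} r)"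
    by (rule bij_betw_byWitness[where f' = sorted_list_of_multiset])
      (auto simp: set multisets_of_size_def sorted_sort_id simp flip: size_mset)
  ultimately show ?thesis using bij_betw_trans by (auto simp: comp_def)
qed

lemma linear_form_nat_perm_rep:
  assumes "h permutes {..<n}" and h: "\<And>i. i < n \<Longrightarrow> g (Suc i) = Suc (h i)" and "i < n"
  shows "linear_form (nat_perm_rep n g :: 'k::field mat) i = Poly_Mapping.single {#h i#} 1"
proof -
  have hi: "h i < n" using permutes_in_image[OF assms(1), of i] assms(3) by simp
  have "linear_form (nat_perm_rep n g :: 'k mat) i
      = (\<Sum>j<n. Poly_Mapping.single {#j#} (if j = h i then 1 else 0))"
    unfolding linear_form_def
    by (rule sum.cong) (use assms(3) h in \<open>auto simp: nat_perm_rep_def\<close>)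
  also have "\<dots> = (\<Sum>j<n. if j = h i then Poly_Mapping.single {#j#} 1 else 0)"
    by (rule sum.cong) auto
  also have "\<dots> = Poly_Mapping.single {#h i#} 1" using hi by simp
  finally show ?thesis .
qed

lemma prod_list_single:
  "(\<Prod>i\<leftarrow>w. Poly_Mapping.single {#h i#} (1 :: 'k::comm_semiring_1))
    = Poly_Mapping.single (mset (map h w)) 1"
  by (induction w) (simp_all add: mult_single)

lemma sym_power_nat_perm_rep:
  fixes n r :: nat
  assumes "h permutes {..<n}" and h: "\<And>i. i < n \<Longrightarrow> g (Suc i) = Suc (h i)"
  defines "e \<equiv> \<lambda>b. mset (sym_basis n r ! b)" and "N \<equiv> length (sym_basis n r)"
  shows "sym_power r (nat_perm_rep n g :: 'k::field mat)
    = mat N N (\<lambda>(a, b). if image_mset h (e b) = e a then 1 else 0)"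
proof (rule eq_matI, goal_cases)
  case (1 a b)
  then have b: "b < N" and a: "a < N" by auto
  have "set_mset (e b) \<subseteq> {..<n}"
    using bij_betw_mset_sym_basis[of n r, THEN bij_betwE] b
    by (auto simp: e_def N_def multisets_of_size_def)
  then have "(\<Prod>i\<leftarrow>sym_basis n r ! b. linear_form (nat_perm_rep n g :: 'k mat) i)
      = (\<Prod>i\<leftarrow>sym_basis n r ! b. Poly_Mapping.single {#h i#} 1)"
    by (intro arg_cong[of _ _ prod_list] map_cong refl linear_form_nat_perm_rep assms)
      (auto simp: e_def)
  also have "\<dots> = Poly_Mapping.single (image_mset h (e b)) 1"
    by (simp add: prod_list_single e_def)
  finally show ?case
    using a b by (simp add: sym_power_def Let_def nat_perm_rep_def[of n g] lookup_single when_def N_def e_def)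
qed (simp_all add: sym_power_def Let_def nat_perm_rep_def N_def)

lemma brauer_value_sym_power:
  fixes \<theta> :: "'k::field alg_closure \<Rightarrow> complex"
  assumes p: "prime p" "CHAR('k) = p" and \<theta>: "brauer_lift p \<theta>"
    and h: "h permutes {..<n}" "\<And>i. i < n \<Longrightarrow> g (Suc i) = Suc (h i)"
    and m: "h ^^ m = id" "coprime m p"
  shows "brauer_value \<theta> (sym_power r (nat_perm_rep n g :: 'k mat))
    = of_nat (card {M \<in> multisets_of_size {..<n} r. image_mset h M = M})"
proof -
  define e where "e = (\<lambda>b. mset (sym_basis n r ! b))"
  define N where "N = length (sym_basis n r)"
  let ?M = "multisets_of_size {..<n} r"
  have e: "bij_betw e {..<N} ?M"
    unfolding e_def N_def by (rule bij_betw_mset_sym_basis)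
  have inj: "inj (image_mset h)"
    by (rule inj_on_inverseI[where g = "image_mset (inv_into UNIV h)"])
      (simp add: multiset.map_comp permutes_inv_o(2)[OF h(1)])
  have sub: "image_mset h ` ?M \<subseteq> ?M"
  proof
    fix A assume "A \<in> image_mset h ` ?M"
    then obtain B where "A = image_mset h B" "set_mset B \<subseteq> {..<n}" "size B = r"
      by (auto simp: multisets_of_size_def)
    moreover from this(2) have "h ` set_mset B \<subseteq> {..<n}"
      using permutes_image[OF h(1)] by blast
    ultimately show "A \<in> ?M" by (simp add: multisets_of_size_def)
  qed
  have "bij_betw (image_mset h) ?M ?M"
    using inj_on_subset[OF inj] sub by (intro bij_betw_imageI endo_inj_surj finite_multisets_of_size) auto
  then obtain s where s: "s permutes {..<N}" "\<And>b. b < N \<Longrightarrow> e (s b) = image_mset h (e b)"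
    using transport_permutation[OF e] by blast
  have einj: "e a = e b \<longleftrightarrow> a = b" if "a < N" "b < N" for a b
    using that bij_betw_imp_inj_on[OF e] by (auto simp: inj_on_def)
  have sN: "s b < N" if "b < N" for b using permutes_in_image[OF s(1), of b] that by simp
  \<comment> \<open>Transporting iterates shows that the permutation \<open>s\<close> of the basis
    again has \<open>m\<close>-th power \<open>id\<close>; hence its cycle lengths are coprime to
    \<open>p\<close> too.\<close>
  have pow: "(s ^^ k) b < N \<and> e ((s ^^ k) b) = (image_mset h ^^ k) (e b)" if "b < N" for k b
    using that by (induction k) (simp_all add: s(2) sN)
  have "(s ^^ m) b = b" for b
  proof (cases "b < N")
    case True
    then show ?thesis
      using pow[OF True, of m] einj[of "(s ^^ m) b" b] m(1) by (simp add: funpow_image_mset)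
  next
    case False
    then show ?thesis
      using permutes_not_in[OF permutes_funpow[OF s(1)]] by simp
  qed
  then have sm: "s ^^ m = id" by auto
  have iff: "image_mset h (e b) = e a \<longleftrightarrow> s b = a" if "a < N" "b < N" for a b
    using einj[of "s b" a] sN[OF that(2)] s(2)[OF that(2)] that(1) by simp
  have sym: "sym_power r (nat_perm_rep n g :: 'k mat)
      = mat N N (\<lambda>(a, b). if image_mset h (e b) = e a then 1 else 0)"
    unfolding N_def e_def by (rule sym_power_nat_perm_rep[OF h])
  have "sym_power r (nat_perm_rep n g :: 'k mat) = mat N N (\<lambda>(a, b). if s b = a then 1 else 0)"
    unfolding sym by (rule eq_matI) (simp_all add: iff)
  then have "brauer_value \<theta> (sym_power r (nat_perm_rep n g :: 'k mat)) = of_nat (card {b. b < N \<and> s b = b})"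
    by (simp add: brauer_value_permutation_matrix[OF p \<theta> s(1) sm m(2)])
  also have "card {b. b < N \<and> s b = b} = card (e ` {b. b < N \<and> s b = b})"
    using bij_betw_imp_inj_on[OF e] by (intro card_image[symmetric]) (auto simp: inj_on_def)
  also have "e ` {b. b < N \<and> s b = b} = {M \<in> e ` {..<N}. image_mset h M = M}"
    using iff by auto
  also have "e ` {..<N} = ?M" using e by (rule bij_betw_imp_surj_on)
  finally show ?thesis .
qed

lemma p_regular_shift:
  assumes "g \<in> p_regular p n"
  obtains h m where "h permutes {..<n}" "\<And>i. g (Suc i) = Suc (h i)" "h ^^ m = id" "coprime m p"
proof -
  let ?G = "sym_group n"
  interpret group ?G by (rule sym_group_is_group)
  define m where "m = ord g"
  \<comment> \<open>The subtraction never truncates: \<open>g\<close> preserves {1..n} and fixes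
    every other number, so \<open>g (Suc i)\<close> is positive.\<close>
  define h where "h = (\<lambda>i. g (Suc i) - 1)"
  have g: "g permutes {1..n}" "g \<in> carrier ?G" "coprime m p"
    using assms by (auto simp: p_regular_def sym_group_carrier m_def)
  have h: "g (Suc i) = Suc (h i)" for i
    using permutes_in_image[OF g(1), of "Suc i"] permutes_not_in[OF g(1), of "Suc i"]
    by (cases "Suc i \<in> {1..n}") (auto simp: h_def)
  have "(g [^]\<^bsub>?G\<^esub> k) = g ^^ k" for k :: nat
    by (induction k) (simp_all add: sym_group_one sym_group_mult funpow_swap1 fun_eq_iff)
  then have gm: "g ^^ m = id" using pow_ord_eq_1[OF g(2)] by (simp add: m_def sym_group_one)
  have pow: "(g ^^ k) (Suc i) = Suc ((h ^^ k) i)" for k i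
    by (induction k) (simp_all add: h)
  have hm: "h ^^ m = id" using pow[of m] gm by (simp add: fun_eq_iff)
  have "bij_betw h {..<n} {..<n}"
  proof (rule bij_betw_imageI)
    show "inj_on h {..<n}" by (rule inj_onI) (metis h permutes_inj[OF g(1)] injD nat.inject)
    moreover have "h ` {..<n} \<subseteq> {..<n}"
    proof
      fix x assume "x \<in> h ` {..<n}"
      then obtain i where "i < n" "x = h i" by auto
      then show "x \<in> {..<n}" using permutes_in_image[OF g(1), of "Suc i"] h[of i] by simp
    qed
    ultimately show "h ` {..<n} = {..<n}" by (intro endo_inj_surj) auto
  qed
  then have "h permutes {..<n}"
  proof (rule bij_imp_permutes)
    fix i assume "i \<notin> {..<n}"
    then show "h i = i" using permutes_not_in[OF g(1), of "Suc i"] h[of i] by simp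
  qed
  then show ?thesis using h hm g(3) that by blast
qed

section \<open>Generating function of the fixed multisets\<close>

definition fixed_multisets :: "('a \<Rightarrow> 'a) \<Rightarrow> 'a set \<Rightarrow> nat \<Rightarrow> 'a multiset set" where
  "fixed_multisets f S r = {M \<in> multisets_of_size S r. image_mset f M = M}"

lemma count_image_mset_inj:
  assumes "inj f"
  shows "count (image_mset f M) (f x) = count M x"
  using assms by (induction M) (auto simp: inj_eq)

lemma count_orbit_fixed:
  assumes "inj f" "image_mset f M = M" "y \<in> orbit f x"
  shows "count M y = count M x"
  using assms(3)
  by induction (use count_image_mset_inj[OF assms(1), of M] assms(2) in auto)

lemma image_mset_orbit:
  assumes "permutation f"
  shows "image_mset f (mset_set (orbit f a)) = mset_set (orbit f a)"
proof -
  have "inj_on f (orbit f a)"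
    using assms by (meson bij_is_inj inj_on_subset permutation subset_UNIV)
  then show ?thesis by (simp add: image_mset_mset_set image_orbit[OF assms])
qed

lemma finite_fixed_multisets: "finite S \<Longrightarrow> finite (fixed_multisets f S r)"
  by (simp add: fixed_multisets_def finite_multisets_of_size)

text \<open>A fixed multiset has constant multiplicity along each orbit. So if it contains
  \<open>a\<close>, it contains a full copy of the orbit, and removing this copy leaves a fixed
  multiset.\<close>

lemma fixed_multisets_split:
  fixes f :: "'a \<Rightarrow> 'a"
  assumes f: "permutation f" and S: "finite S" "f ` S = S" "a \<in> S"
  defines "C \<equiv> orbit f a"
  shows "{M \<in> fixed_multisets f S r. a \<notin># M} = fixed_multisets f (S - C) r" (is ?A)
    and "{M \<in> fixed_multisets f S r. a \<in># M}
      = (if card C \<le> r then (\<lambda>M. M + mset_set C) ` fixed_multisets f S (r - card C) else {})" (is ?B)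
proof -
  have inj: "inj f" using f by (simp add: bij_is_inj permutation)
  have sub: "C \<subseteq> S" unfolding C_def by (rule orbit_subset_invariant[OF S(2,3)])
  have aC: "a \<in> C" unfolding C_def by (rule permutation_self_in_orbit[OF f])
  have finC: "finite C" using finite_subset[OF sub S(1)] .
  have const: "count M x = count M a" if "M \<in> fixed_multisets f S r" "x \<in> C" for M x
    using count_orbit_fixed[OF inj, of M x a] that by (simp add: fixed_multisets_def C_def)
  show ?A
  proof (intro equalityI subsetI)
    fix M assume "M \<in> {M \<in> fixed_multisets f S r. a \<notin># M}"
    then have M: "M \<in> fixed_multisets f S r" "count M a = 0" by (auto simp: count_eq_zero_iff)
    then have "x \<notin># M" if "x \<in> C" for x using const[OF M(1) that] M(2) by (metis count_eq_zero_iff)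
    then show "M \<in> fixed_multisets f (S - C) r"
      using M(1) by (auto simp: fixed_multisets_def multisets_of_size_def)
  next
    fix M assume "M \<in> fixed_multisets f (S - C) r"
    then show "M \<in> {M \<in> fixed_multisets f S r. a \<notin># M}"
      using aC by (auto simp: fixed_multisets_def multisets_of_size_def)
  qed
  have le: "mset_set C \<subseteq># M" if "M \<in> fixed_multisets f S r" "a \<in># M" for M
    using const[OF that(1)] that(2) finC by (intro mset_subset_eqI) (auto simp: count_mset_set' Suc_le_eq)
  have inv: "image_mset f (mset_set C) = mset_set C"
    unfolding C_def by (rule image_mset_orbit[OF f])
  show ?B
  proof (cases "card C \<le> r")
    case True
    have "{M \<in> fixed_multisets f S r. a \<in># M} = (\<lambda>M. M + mset_set C) ` fixed_multisets f S (r - card C)"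
    proof (intro equalityI subsetI)
      fix M assume M: "M \<in> {M \<in> fixed_multisets f S r. a \<in># M}"
      then have sub: "mset_set C \<subseteq># M" by (intro le) auto
      define M' where "M' = M - mset_set C"
      have eq: "M = M' + mset_set C" using sub by (simp add: M'_def)
      have "image_mset f M' = M'"
        using M inv by (auto simp: fixed_multisets_def eq)
      then have "M' \<in> fixed_multisets f S (r - card C)"
        using M by (auto simp: fixed_multisets_def multisets_of_size_def eq)
      then show "M \<in> (\<lambda>M. M + mset_set C) ` fixed_multisets f S (r - card C)"
        unfolding eq by (rule imageI)
    next
      fix M assume "M \<in> (\<lambda>M. M + mset_set C) ` fixed_multisets f S (r - card C)"
      then show "M \<in> {M \<in> fixed_multisets f S r. a \<in># M}"
        using True sub inv finC aC by (auto simp: fixed_multisets_def multisets_of_size_def)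
    qed
    then show ?thesis using True by simp
  next
    case False
    have "card C \<le> r" if "M \<in> fixed_multisets f S r" "a \<in># M" for M
      using size_mset_mono[OF le[OF that]] that(1)
      by (simp add: fixed_multisets_def multisets_of_size_def)
    with False have "{M \<in> fixed_multisets f S r. a \<in># M} = {}" by blast
    then show ?thesis using False by simp
  qed
qed

text \<open>Coefficientwise form of (1 - X^l) G_S = G_(S-C) for the generating functions, where l is
  the size of the orbit C.\<close>

lemma card_fixed_multisets_remove_orbit:
  assumes f: "permutation f" and S: "finite S" "f ` S = S" "a \<in> S"
  defines "C \<equiv> orbit f a"
  shows "card (fixed_multisets f S r) = card (fixed_multisets f (S - C) r)
    + (if card C \<le> r then card (fixed_multisets f S (r - card C)) else 0)"
proof -
  note split = fixed_multisets_split[OF f S, of r, folded C_def]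
  have "fixed_multisets f S r
      = {M \<in> fixed_multisets f S r. a \<notin># M} \<union> {M \<in> fixed_multisets f S r. a \<in># M}" by auto
  then have "card (fixed_multisets f S r)
      = card {M \<in> fixed_multisets f S r. a \<notin># M} + card {M \<in> fixed_multisets f S r. a \<in># M}"
    using finite_fixed_multisets[OF S(1), of f r]
    by (metis (no_types, lifting) card_Un_disjoint finite_Un disjoint_iff mem_Collect_eq)
  also have "card {M \<in> fixed_multisets f S r. a \<in># M}
      = (if card C \<le> r then card (fixed_multisets f S (r - card C)) else 0)"
    unfolding split(2) by (simp add: card_image)
  finally show ?thesis unfolding split(1) .
qed

text \<open>The factors X^l - 1 instead of 1 - X^l keep the polynomials monic and of the same form
  as the characteristic polynomials; the price is one sign per cycle.\<close>

lemma fixed_multisets_generating_function: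
  fixes f :: "'a \<Rightarrow> 'a"
  assumes f: "permutation f" and "finite S" "f ` S = S"
  shows "Abs_fps (\<lambda>r. of_nat (card (fixed_multisets f S r)))
      * fps_of_poly (\<Prod>l\<in>#cycle_lengths f S. monom 1 l - 1)
    = ((- 1) ^ size (cycle_lengths f S) :: 'b::comm_ring_1 fps)"
  using assms
proof (induction S rule: invariant_set_induct)
  case empty
  have "fixed_multisets f {} r = (if r = 0 then {{#}} else {})" for r
    by (auto simp: fixed_multisets_def)
  then have "Abs_fps (\<lambda>r. of_nat (card (fixed_multisets f {} r))) = (1 :: 'b fps)"
    by (intro fps_ext) simp
  then show ?case by simp
next
  case (orbit S a)
  define l where "l = card (orbit f a)"
  let ?G = "\<lambda>S. Abs_fps (\<lambda>r. of_nat (card (fixed_multisets f S r))) :: 'b fps"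
  let ?P = "\<lambda>S. fps_of_poly (\<Prod>l\<in>#cycle_lengths f S. monom 1 l - 1) :: 'b fps"
  note rec = cycle_lengths_remove_orbit[OF f orbit(1-3)]
  have "?G S * (fps_X ^ l - 1) = - ?G (S - orbit f a)"
  proof (rule fps_ext)
    fix r
    show "(?G S * (fps_X ^ l - 1)) $ r = (- ?G (S - orbit f a)) $ r"
      using card_fixed_multisets_remove_orbit[OF f orbit(1-3), of r]
      by (simp add: right_diff_distrib fps_X_power_mult_right_nth l_def)
  qed
  moreover have "?P S = (fps_X ^ l - 1) * ?P (S - orbit f a)"
    by (simp add: rec l_def fps_of_poly_mult fps_of_poly_diff fps_of_poly_monom')
  ultimately have "?G S * ?P S = - (?G (S - orbit f a) * ?P (S - orbit f a))"
    by (metis (no_types, lifting) mult.assoc mult_minus_left)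
  then show ?case using orbit(6) rec by simp
qed

section \<open>The common denominator\<close>

definition coprime_part :: "nat \<Rightarrow> nat \<Rightarrow> nat" where
  "coprime_part p m = m div p ^ multiplicity p m"

lemma coprime_part_pos:
  assumes "prime p" "m > 0"
  shows "coprime_part p m > 0"
proof -
  have "p ^ multiplicity p m \<noteq> 0" using assms(1) by (auto simp: prime_gt_0_nat)
  moreover have "p ^ multiplicity p m \<le> m"
    using assms(2) by (intro dvd_imp_le multiplicity_dvd)
  ultimately show ?thesis by (simp add: coprime_part_def div_greater_zero_iff)
qed

lemma dvd_coprime_part:
  assumes "d dvd m" "coprime d p"
  shows "d dvd coprime_part p m"
proof -
  have "m = p ^ multiplicity p m * coprime_part p m"
    by (simp add: coprime_part_def multiplicity_dvd)
  then have "d dvd p ^ multiplicity p m * coprime_part p m" using assms(1) by simp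
  then show ?thesis
    using assms(2) by (simp add: coprime_dvd_mult_right_iff)
qed

lemma coprime_part_eq:
  assumes "\<not> p dvd m"
  shows "coprime_part p m = m"
  using assms by (simp add: coprime_part_def not_dvd_imp_multiplicity_0)

lemma coprime_part_mult_self:
  assumes "prime p" "m > 0"
  shows "coprime_part p (p * m) = coprime_part p m"
proof -
  have "multiplicity p (p * m) = Suc (multiplicity p m)"
    using assms by (intro multiplicity_times_same) (auto simp: not_prime_unit)
  then show ?thesis using prime_gt_0_nat[OF assms(1)] by (simp add: coprime_part_def)
qed

section \<open>Comparing denominators through multiplicities of roots of unity\<close>

lemma prod_monom_minus_1_neq_0:
  assumes "\<And>l. l \<in># M \<Longrightarrow> l > 0"
  shows "(\<Prod>l\<in>#M. monom 1 l - 1) \<noteq> (0 :: 'a::idom poly)"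
  using assms by (induction M) (simp_all add: monom_minus_1_neq_0 del: right_minus_eq)

lemma count_proots_prod_monom_minus_1:
  fixes z :: "'a::field_char_0"
  assumes "\<And>l. l \<in># M \<Longrightarrow> l > 0"
  shows "count (proots (\<Prod>l\<in>#M. monom 1 l - 1)) z = size {#l \<in># M. z ^ l = 1#}"
  using assms
proof (induction M)
  case (add l M)
  have "monom 1 l - 1 \<noteq> (0 :: 'a poly)" using add.prems by (intro monom_minus_1_neq_0) simp
  moreover have "(\<Prod>l\<in>#M. monom 1 l - 1) \<noteq> (0 :: 'a poly)"
    using add.prems by (intro prod_monom_minus_1_neq_0) simp
  moreover have "of_nat l \<noteq> (0 :: 'a)" using add.prems by simp
  ultimately show ?case using add by (simp add: proots_mult order_monom_minus_1)
qed simp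

text \<open>Over an algebraically closed field a nonzero polynomial is a scalar times the product of
  its linear factors, so inclusion of root multisets is divisibility.\<close>

lemma proots_subset_imp_dvd:
  fixes P Q :: "'a::alg_closed_field poly"
  assumes "P \<noteq> 0" "proots P \<subseteq># proots Q"
  shows "P dvd Q"
proof (cases "Q = 0")
  case False
  have factor: "R = smult (lead_coeff R) (\<Prod>x\<in>#proots R. [:-x, 1:])" if R: "R \<noteq> 0" for R :: "'a poly"
  proof -
    obtain A where A: "R = smult (lead_coeff R) (\<Prod>x\<in>#A. [:-x, 1:])"
      using alg_closed_imp_factorization[OF R] by blast
    have "proots (\<Prod>x\<in>#A. [:-x, 1:]) = A"
    proof (induction A)
      case (add x A)
      have "(\<Prod>x\<in>#A. [:-x, 1:]) \<noteq> 0" by (auto simp: prod_mset_zero_iff)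
      then show ?case
        using add by (simp add: proots_mult del: mult_pCons_left)
    qed simp
    then have "proots R = A"
      by (subst A) (use R in simp)
    with A show ?thesis by simp
  qed
  have "(\<Prod>x\<in>#proots P. [:-x, 1:]) dvd (\<Prod>x\<in>#proots Q. [:-x, 1:])"
    using assms(2) by (intro prod_mset_subset_imp_dvd image_mset_subseteq_mono)
  then show ?thesis
    using assms(1) False by (subst factor[OF assms(1)], subst factor[OF False]) (simp add: smult_dvd_iff dvd_smult)
qed simp

lemma exists_multiplicative_order:
  fixes z :: "'a::field"
  assumes "z ^ l = 1" "l > 0"
  obtains d where "d > 0" "\<And>k. z ^ k = 1 \<longleftrightarrow> d dvd k"
proof -
  define d where "d = (LEAST k. k > 0 \<and> z ^ k = 1)"
  have d: "d > 0 \<and> z ^ d = 1" unfolding d_def by (rule LeastI[of _ l]) (use assms in simp)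
  have "z ^ k = z ^ (k mod d)" for k
  proof -
    have "z ^ k = z ^ (d * (k div d) + k mod d)" by simp
    then show ?thesis using d by (simp only: power_add power_mult) simp
  qed
  moreover have "z ^ k \<noteq> 1" if "0 < k" "k < d" for k
    using not_less_Least[of k "\<lambda>k. k > 0 \<and> z ^ k = 1"] that unfolding d_def by blast
  ultimately have "z ^ k = 1 \<longleftrightarrow> d dvd k" for k
    using d mod_less_divisor[of d k] by (metis dvd_eq_mod_eq_0 gr0I power_0)
  with d that show ?thesis by blast
qed

lemma size_filter_dvd_mult_le:
  fixes d :: nat
  assumes "\<And>l. l \<in># L \<Longrightarrow> l > 0"
  shows "size {#l \<in># L. d dvd l#} * d \<le> sum_mset L"
  using assms
proof (induction L)
  case (add l L)
  then have "size {#l \<in># L. d dvd l#} * d \<le> sum_mset L" by simp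
  moreover have "d \<le> l" if "d dvd l" using that add.prems by (intro dvd_imp_le) auto
  ultimately show ?case by auto
qed simp

definition coprime_parts :: "nat \<Rightarrow> nat \<Rightarrow> nat multiset" where
  "coprime_parts p n = image_mset (coprime_part p) (mset_set {1..n})"

text \<open>Let z have order d. On the left its multiplicity is the number of lengths divisible by
  d, at most \<open>n div d\<close> because the lengths sum to \<open>n\<close>. On the right each
  of the \<open>n div d\<close> multiples of d up to \<open>n\<close> counts, since d is coprime to
  \<open>p\<close> and so divides the coprime part.\<close>

lemma prod_monom_minus_1_dvd:
  assumes p: "prime p" and L: "\<And>l. l \<in># L \<Longrightarrow> coprime l p" and n: "sum_mset L = n"
  shows "(\<Prod>l\<in>#L. monom 1 l - 1 :: complex poly) dvd (\<Prod>l\<in>#coprime_parts p n. monom 1 l - 1)"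
proof (rule proots_subset_imp_dvd)
  have pos: "l > 0" if "l \<in># L" for l using L[OF that] p by (cases l) auto
  have pos': "l > 0" if "l \<in># coprime_parts p n" for l
    using that coprime_part_pos[OF p] by (auto simp: coprime_parts_def)
  show "(\<Prod>l\<in>#L. monom 1 l - 1 :: complex poly) \<noteq> 0"
    using pos by (rule prod_monom_minus_1_neq_0)
  show "proots (\<Prod>l\<in>#L. monom 1 l - 1 :: complex poly)
    \<subseteq># proots (\<Prod>l\<in>#coprime_parts p n. monom 1 l - 1)"
  proof (rule mset_subset_eqI)
    fix z :: complex
    have "size {#l \<in># L. z ^ l = 1#} \<le> size {#l \<in># coprime_parts p n. z ^ l = 1#}"
    proof (cases "\<exists>l\<in>#L. z ^ l = 1")
      case False
      then have "{#l \<in># L. z ^ l = 1#} = {#}" by simp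
      then show ?thesis by (simp only: size_empty zero_le)
    next
      case True
      then obtain l where l: "l \<in># L" "z ^ l = 1" by blast
      obtain d where d: "d > 0" "\<And>k. z ^ k = 1 \<longleftrightarrow> d dvd k"
        using exists_multiplicative_order[OF l(2) pos[OF l(1)]] by blast
      \<comment> \<open>\<open>d\<close> divides the length \<open>l\<close>, which is coprime to
        \<open>p\<close>. A root whose order is not coprime to \<open>p\<close> therefore has
        multiplicity 0 on the left.\<close>
      have "coprime d p" using L[OF l(1)] l(2) d(2) coprime_divisors[of d l p p] by simp
      have "size {#l \<in># L. d dvd l#} * d \<le> n"
        unfolding n[symmetric] by (rule size_filter_dvd_mult_le) (rule pos)
      then have "size {#l \<in># L. d dvd l#} \<le> n div d"
        using d(1) by (simp add: less_eq_div_iff_mult_less_eq)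
      also have "\<dots> = card ((*) d ` {1..n div d})"
        using d(1) by (subst card_image) (auto simp: inj_on_def)
      also have "\<dots> \<le> card {m \<in> {1..n}. d dvd coprime_part p m}"
      proof (rule card_mono)
        show "(*) d ` {1..n div d} \<subseteq> {m \<in> {1..n}. d dvd coprime_part p m}"
        proof
          fix m assume "m \<in> (*) d ` {1..n div d}"
          then obtain k where "k \<in> {1..n div d}" "m = d * k" by (rule imageE)
          then have k: "m = d * k" "1 \<le> k" "k \<le> n div d" by simp_all
          then have "m \<le> n" using d(1) by (simp add: less_eq_div_iff_mult_less_eq mult.commute)
          moreover have "1 \<le> m" using k d(1) by simp
          moreover have "d dvd coprime_part p m"
            using k(1) \<open>coprime d p\<close> by (intro dvd_coprime_part) simp_all
          ultimately show "m \<in> {m \<in> {1..n}. d dvd coprime_part p m}" by simp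
        qed
      qed simp
      also have "\<dots> = size {#l \<in># coprime_parts p n. d dvd l#}"
        by (simp add: coprime_parts_def filter_mset_image_mset filter_mset_mset_set)
      finally show ?thesis by (simp add: d(2))
    qed
    then show "count (proots (\<Prod>l\<in>#L. monom 1 l - 1 :: complex poly)) z
      \<le> count (proots (\<Prod>l\<in>#coprime_parts p n. monom 1 l - 1)) z"
      using pos pos' by (simp only: count_proots_prod_monom_minus_1)
  qed
qed

lemma degree_prod_monom_minus_1:
  assumes "\<And>l. l \<in># M \<Longrightarrow> l > 0"
  shows "degree (\<Prod>l\<in>#M. monom 1 l - 1 :: 'a::idom poly) = sum_mset M"
  using assms
proof (induction M)
  case (add l M)
  have "monom 1 l - 1 \<noteq> (0 :: 'a poly)" using add.prems by (intro monom_minus_1_neq_0) simp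
  moreover have "(\<Prod>l\<in>#M. monom 1 l - 1) \<noteq> (0 :: 'a poly)"
    using add.prems by (intro prod_monom_minus_1_neq_0) simp
  moreover have "degree (monom 1 l - 1 :: 'a poly) = l"
    using add.prems by (intro antisym degree_le le_degree) (auto simp: coeff_eq_0)
  ultimately show ?case using add by (simp add: degree_mult_eq)
qed simp

section \<open>Degree of the common denominator\<close>

text \<open>Numbers prime to \<open>p\<close> are their own coprime part, and \<open>p * q\<close>
  has the same coprime part as \<open>q\<close>. The sum of the multiples of \<open>p\<close> stands
  on the left to avoid subtraction of naturals.\<close>

lemma sum_coprime_part_rec:
  assumes p: "prime p"
  shows "(\<Sum>m=1..n. coprime_part p m) + p * (\<Sum>q=1..n div p. q)
    = (\<Sum>m=1..n. m) + (\<Sum>q=1..n div p. coprime_part p q)"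
proof -
  have p0: "p > 0" using prime_gt_0_nat[OF p] .
  let ?D = "{m \<in> {1..n}. p dvd m}" and ?N = "{m \<in> {1..n}. \<not> p dvd m}"
  have D: "?D = (*) p ` {1..n div p}"
  proof (intro equalityI subsetI)
    fix m assume "m \<in> ?D"
    then obtain k where k: "m = p * k" "1 \<le> m" "m \<le> n" by auto
    then have "1 \<le> k" "k \<le> n div p"
      using p0 by (auto simp: less_eq_div_iff_mult_less_eq mult.commute intro!: Suc_leI)
    then show "m \<in> (*) p ` {1..n div p}" using k(1) by auto
  next
    fix m assume "m \<in> (*) p ` {1..n div p}"
    then obtain k where "k \<in> {1..n div p}" "m = p * k" by (rule imageE)
    then show "m \<in> ?D" using p0 by (auto simp: less_eq_div_iff_mult_less_eq mult.commute)
  qed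
  have split: "(\<Sum>m=1..n. f m) = (\<Sum>q=1..n div p. f (p * q)) + (\<Sum>m\<in>?N. f m)" for f :: "nat \<Rightarrow> nat"
  proof -
    have "(\<Sum>m=1..n. f m) = (\<Sum>m\<in>?D \<union> ?N. f m)" by (rule sum.cong) auto
    also have "\<dots> = (\<Sum>m\<in>?D. f m) + (\<Sum>m\<in>?N. f m)" by (rule sum.union_disjoint) auto
    also have "(\<Sum>m\<in>?D. f m) = (\<Sum>q=1..n div p. f (p * q))"
      unfolding D using p0 by (subst sum.reindex) (auto simp: inj_on_def)
    finally show ?thesis .
  qed
  have "(\<Sum>q=1..n div p. coprime_part p (p * q)) = (\<Sum>q=1..n div p. coprime_part p q)"
    by (rule sum.cong) (use coprime_part_mult_self[OF p] in auto)
  moreover have "(\<Sum>m\<in>?N. coprime_part p m) = (\<Sum>m\<in>?N. m)"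
    by (rule sum.cong) (auto simp: coprime_part_eq)
  ultimately show ?thesis
    using split[of "coprime_part p"] split[of "\<lambda>m. m"] by (simp add: sum_distrib_left)
qed

lemma real_sum_upto: "real (\<Sum>m=1..n. m) = real n * (real n + 1) / 2"
  by (induction n) (auto simp: field_simps)

text \<open>The last summand \<open>n\<close> makes room for the rounding error in
  \<open>n div p\<close>; in the final estimate it cancels against the \<open>n\<close> subtracted
  from the degree of the denominator.\<close>

lemma sum_coprime_part_bound:
  assumes p: "prime p" and "n \<ge> 1"
  shows "real (\<Sum>m=1..n. coprime_part p m)
    \<le> real p / (2 * real p + 2) * (real n)\<^sup>2 + real n * log (real p) (real n) + real n"
  using assms(2)
proof (induction n rule: less_induct)
  case (less n)
  define q where "q = n div p"
  define P x y where "P = real p" and "x = real n" and "y = real q"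
  have P: "P \<ge> 2" using prime_ge_2_nat[OF p] by (simp add: P_def)
  have x: "x \<ge> 1" using less.prems by (simp add: x_def)
  have y: "y \<ge> 0" by (simp add: y_def)
  define S where "S = (\<lambda>n. real (\<Sum>m=1..n. coprime_part p m))"
  have rec: "S n + P * (y * (y + 1) / 2) = x * (x + 1) / 2 + S q"
    using arg_cong[OF sum_coprime_part_rec[OF p, of n], of real]
    unfolding S_def P_def x_def y_def q_def of_nat_add of_nat_mult real_sum_upto .
  have "n = p * q + n mod p" by (simp add: q_def)
  moreover have "n mod p < p" using prime_gt_0_nat[OF p] by simp
  ultimately have "p * q \<le> n" "n + 1 \<le> p * q + p" by linarith+
  then have q: "P * y \<le> x" "x + 1 \<le> P * y + P"
    unfolding P_def x_def y_def by (simp_all flip: of_nat_mult of_nat_add of_nat_Suc)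
  define c where "c = P / (2 * P + 2)"
  have cP: "c * (2 * P + 2) = P" using P by (simp add: c_def)
  \<comment> \<open>For this \<open>c\<close>, multiplying by \<open>2 * P + 2\<close> collapses the
    quadratic terms to (x - P y)(x + P y). The first factor is the remainder modulo
    \<open>p\<close>, at most \<open>P - 1\<close>, and the second is at most 2x.\<close>
  have quad: "x\<^sup>2 / 2 - P * y\<^sup>2 / 2 + c * y\<^sup>2 \<le> c * x\<^sup>2 + x"
  proof -
    have "(x - P * y) * (x + P * y) \<le> (P - 1) * (x + x)"
      using q x y P by (intro mult_mono) auto
    then have "x\<^sup>2 - P\<^sup>2 * y\<^sup>2 \<le> (2 * P + 2) * x"
      using x by (simp add: algebra_simps power2_eq_square)
    moreover have "(2 * P + 2) * (x\<^sup>2 / 2 - P * y\<^sup>2 / 2 + c * y\<^sup>2 - c * x\<^sup>2) = x\<^sup>2 - P\<^sup>2 * y\<^sup>2"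
    proof -
      have "(2 * P + 2) * (x\<^sup>2 / 2 - P * y\<^sup>2 / 2 + c * y\<^sup>2 - c * x\<^sup>2)
        = (P + 1) * x\<^sup>2 - (P + 1) * P * y\<^sup>2 + c * (2 * P + 2) * y\<^sup>2 - c * (2 * P + 2) * x\<^sup>2"
        by (simp add: algebra_simps add_divide_distrib diff_divide_distrib)
      then show ?thesis unfolding cP by (simp add: algebra_simps power2_eq_square)
    qed
    ultimately have "(2 * P + 2) * (x\<^sup>2 / 2 - P * y\<^sup>2 / 2 + c * y\<^sup>2 - c * x\<^sup>2) \<le> (2 * P + 2) * x"
      by simp
    then have "x\<^sup>2 / 2 - P * y\<^sup>2 / 2 + c * y\<^sup>2 - c * x\<^sup>2 \<le> x" using P by simp
    then show ?thesis by simp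
  qed
  have log_nonneg: "log P x \<ge> 0" using P x by simp
  have "S n \<le> c * x\<^sup>2 + x * log P x + x"
  proof (cases "q = 0")
    case True
    then have y0: "y = 0" by (simp add: y_def)
    then have "x + 1 \<le> P" using q by simp
    \<comment> \<open>Here \<open>n < p\<close>. After multiplication by \<open>2 * P + 2\<close>,
      the bound \<open>x * (x + 1) / 2 <= c * x^2 + x\<close> amounts to exactly this
      inequality.\<close>
    have "(P + 1) * x \<ge> x * x" using \<open>x + 1 \<le> P\<close> x by (intro mult_right_mono) auto
    moreover have "(2 * P + 2) * (x * (x + 1) / 2) = (P + 1) * x * x + (P + 1) * x"
      by (simp add: field_simps)
    moreover have "(2 * P + 2) * (c * x\<^sup>2 + x) = P * x * x + 2 * ((P + 1) * x)"
    proof -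
      have "(2 * P + 2) * (c * x\<^sup>2 + x) = c * (2 * P + 2) * x\<^sup>2 + 2 * ((P + 1) * x)"
        by (simp add: algebra_simps)
      then show ?thesis unfolding cP by (simp add: power2_eq_square)
    qed
    moreover have "(P + 1) * x * x = P * x * x + x * x" by (simp add: algebra_simps)
    ultimately have "(2 * P + 2) * (x * (x + 1) / 2) \<le> (2 * P + 2) * (c * x\<^sup>2 + x)" by linarith
    then have "x * (x + 1) / 2 \<le> c * x\<^sup>2 + x" using P by simp
    moreover have "S n = x * (x + 1) / 2" using rec True y0 by (simp add: S_def)
    moreover have "x * log P x \<ge> 0" using log_nonneg x by simp
    ultimately show ?thesis by linarith
  next
    case False
    then have y1: "y \<ge> 1" by (simp add: y_def)
    have "q < n" using less.prems prime_gt_1_nat[OF p] by (simp add: q_def)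
    then have IH: "S q \<le> c * y\<^sup>2 + y * log P y + y"
      using less.IH[of q] False unfolding S_def c_def P_def y_def by simp
    have "y \<le> x / P" using q P by (simp add: field_simps)
    then have "log P y \<le> log P (x / P)" using P y1 x by (subst log_le_cancel_iff) auto
    also have "\<dots> = log P x - 1" using P x by (subst log_divide) auto
    finally have logy: "log P y \<le> log P x - 1" .
    have log1: "log P x \<ge> 1"
    proof -
      have "P * 1 \<le> P * y" using y1 P by (intro mult_left_mono) auto
      with q(1) have "P \<le> x" by simp
      then show ?thesis using P by simp
    qed
    \<comment> \<open>The logarithm drops by at least 1 from \<open>x\<close> to \<open>y\<close>,
      which cancels the summand \<open>y\<close> of the induction hypothesis. What remains, x/2 - P
      y/2, is at most x - y and is absorbed by (x - y) log x.\<close>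
    have "y * log P y \<le> y * (log P x - 1)" using logy y by (rule mult_left_mono)
    moreover have "2 * y \<le> P * y" using P y by (rule mult_right_mono)
    moreover have "y \<le> x" using \<open>2 * y \<le> P * y\<close> q(1) y by linarith
    moreover have "(x - y) * log P x \<ge> (x - y) * 1"
      using log1 \<open>y \<le> x\<close> by (intro mult_left_mono) auto
    moreover have "S n = x\<^sup>2 / 2 + x / 2 - P * y\<^sup>2 / 2 - P * y / 2 + S q"
      using rec by (simp add: field_simps power2_eq_square)
    ultimately show ?thesis using IH quad x by (simp add: algebra_simps)
  qed
  then show ?case by (simp add: S_def c_def P_def x_def)
qed

section \<open>Dimension of the span\<close>

lemma cfun_sum_apply: "(\<Sum>j\<in>A. F j) x = (\<Sum>j\<in>A. F j x :: complex)"
  by (induction A rule: infinite_finite_induct) simp_all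

text \<open>The index \<open>r\<close> enters only through scalars, so all \<open>b r\<close> lie in
  the span of the \<open>K + 1\<close> functions \<open>c 0\<close>, ...,
  \<open>c K\<close>.\<close>

lemma cfun_dim_le:
  fixes b :: "'i \<Rightarrow> 'a \<Rightarrow> complex"
  assumes "\<And>r x. b r x = (\<Sum>j\<le>K. a j r * c j x)"
  shows "cfun_dim (cfun_span (range b)) \<le> K + 1"
proof -
  have "b r \<in> cfun_span (c ` {..K})" for r
  proof -
    have "b r = (\<Sum>j\<le>K. (\<lambda>x. a j r * c j x))"
      by (rule ext) (simp add: assms cfun_sum_apply)
    also have "\<dots> \<in> cfun_span (c ` {..K})"
      by (intro cfun.span_sum cfun.span_scale cfun.span_base) simp
    finally show ?thesis .
  qed
  then have "cfun_span (range b) \<subseteq> cfun_span (c ` {..K})"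
    by (intro cfun.span_minimal cfun.subspace_span) auto
  then have "cfun_dim (cfun_span (range b)) \<le> card (c ` {..K})"
    by (rule cfun.dim_le_card) simp
  also have "\<dots> \<le> K + 1"
    using card_image_le[of "{..K}" c] by simp
  finally show ?thesis .
qed

text \<open>The series X^j / D are the same for all \<open>g\<close>; only the coefficients
  \<open>q j\<close> of the numerator depend on \<open>g\<close>. Up to sign the numerator is the
  cofactor of the denominator at \<open>g\<close> in \<open>D\<close>, so its degree is deg D - n
  whatever the cycle type.\<close>

lemma sym_brauer_char_p_regular:
  fixes \<theta> :: "'k::field alg_closure \<Rightarrow> complex"
  assumes p: "prime p" "CHAR('k) = p" and \<theta>: "brauer_lift p \<theta>" and g: "g \<in> p_regular p n"
  defines "K \<equiv> (\<Sum>m=1..n. coprime_part p m) - n"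
    and "D \<equiv> fps_of_poly (\<Prod>l\<in>#coprime_parts p n. monom 1 l - 1) :: complex fps"
  shows "\<exists>q. \<forall>r. sym_brauer_char p \<theta> n r g = (\<Sum>j\<le>K. (fps_X ^ j * inverse D) $ r * q j)"
proof -
  obtain h m where h: "h permutes {..<n}" "\<And>i. g (Suc i) = Suc (h i)"
    and m: "h ^^ m = id" "coprime m p"
    using p_regular_shift[OF g] by blast
  have perm: "permutation h" by (rule permutes_imp_permutation[OF _ h(1)]) simp
  note inv = finite_lessThan[of n] permutes_image[OF h(1)]
  define L where "L = cycle_lengths h {..<n}"
  define G where "G = Abs_fps (\<lambda>r. of_nat (card (fixed_multisets h {..<n} r)) :: complex)"
  let ?P = "\<Prod>l\<in>#L. monom 1 l - 1 :: complex poly"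
  let ?D = "\<Prod>l\<in>#coprime_parts p n. monom 1 l - 1 :: complex poly"
  have char: "sym_brauer_char p \<theta> n r g = G $ r" for r
    using g brauer_value_sym_power[OF p \<theta> h(1) _ m, of g r] h(2)
    by (simp add: sym_brauer_char_def G_def fixed_multisets_def)
  have sumL: "sum_mset L = n"
    using sum_cycle_lengths[OF perm inv] by (simp add: L_def)
  have cop: "coprime l p" if "l \<in># L" for l
    using coprime_cycle_length[OF perm m] that by (simp add: L_def)
  have pos: "l > 0" if "l \<in># L" for l using cop[OF that] p(1) by (cases l) auto
  have pos': "l > 0" if "l \<in># coprime_parts p n" for l
    using that coprime_part_pos[OF p(1)] by (auto simp: coprime_parts_def)
  obtain Q where Q: "?D = ?P * Q"
    using prod_monom_minus_1_dvd[OF p(1) cop sumL] by (rule dvdE)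
  have "?D \<noteq> 0" using pos' by (rule prod_monom_minus_1_neq_0)
  then have "degree ?D = degree ?P + degree Q"
    unfolding Q by (intro degree_mult_eq) auto
  moreover have "degree ?D = sum_mset (coprime_parts p n)"
    using pos' by (rule degree_prod_monom_minus_1)
  moreover have "sum_mset (coprime_parts p n) = (\<Sum>m=1..n. coprime_part p m)"
    by (simp add: coprime_parts_def sum_unfold_sum_mset)
  moreover have "degree ?P = sum_mset L"
    using pos by (rule degree_prod_monom_minus_1)
  ultimately have degQ: "degree Q = K" by (simp add: K_def sumL)
  define s :: complex where "s = (- 1) ^ size L"
  have "G * fps_of_poly ?P = (- 1) ^ size L"
    using fixed_multisets_generating_function[OF perm inv] unfolding G_def L_def .
  then have "G * D = fps_const s * fps_of_poly Q"
    unfolding D_def Q fps_of_poly_mult mult.assoc[symmetric]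
    by (simp add: s_def flip: fps_const_power fps_const_neg)
  moreover have "D * inverse D = 1"
  proof -
    \<comment> \<open>Each factor X^l - 1 with l > 0 has constant term -1, so \<open>D\<close> is
      invertible as a power series.\<close>
    have "poly ?D 0 \<noteq> 0"
      by (auto simp: poly_prod_mset poly_monom prod_mset_zero_iff power_0_left
          dest!: pos' split: if_splits)
    then have "D $ 0 \<noteq> 0" by (simp add: D_def poly_0_coeff_0)
    then show ?thesis by (rule inverse_mult_eq_1')
  qed
  ultimately have G: "G = fps_const s * fps_of_poly Q * inverse D"
    by (metis mult.assoc mult.right_neutral)
  have "fps_of_poly Q = (\<Sum>j\<le>K. fps_const (coeff Q j) * fps_X ^ j)"
    unfolding degQ[symmetric]
    by (subst poly_as_sum_of_monoms[of Q, symmetric]) (simp add: fps_of_poly_sum fps_of_poly_monom)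
  then have "G = (\<Sum>j\<le>K. fps_const (s * coeff Q j) * (fps_X ^ j * inverse D))"
    unfolding G by (simp add: sum_distrib_left sum_distrib_right mult.assoc flip: fps_const_mult)
  then have "sym_brauer_char p \<theta> n r g = (\<Sum>j\<le>K. (fps_X ^ j * inverse D) $ r * (s * coeff Q j))" for r
    unfolding char by (simp add: fps_sum_nth mult.commute)
  then show ?thesis by (intro exI[of _ "\<lambda>j. s * coeff Q j"] allI)
qed

lemma brauer_span_dim_le:
  fixes \<theta> :: "'k::field alg_closure \<Rightarrow> complex"
  assumes "prime p" "CHAR('k) = p" "brauer_lift p \<theta>"
  shows "brauer_span_dim p \<theta> n \<le> (\<Sum>m=1..n. coprime_part p m) - n + 1"
proof -
  define K where "K = (\<Sum>m=1..n. coprime_part p m) - n"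
  define a where "a = (\<lambda>j r. (fps_X ^ j * inverse (fps_of_poly
    (\<Prod>l\<in>#coprime_parts p n. monom 1 l - 1) :: complex fps)) $ r)"
  have "\<exists>q. \<forall>r. sym_brauer_char p \<theta> n r g = (\<Sum>j\<le>K. a j r * q j)" for g
  proof (cases "g \<in> p_regular p n")
    case True
    then show ?thesis
      unfolding K_def a_def by (rule sym_brauer_char_p_regular[OF assms])
  next
    case False
    \<comment> \<open>Outside the regular elements the characters are 0 by their encoding, so zero
      coefficients extend the formula to all \<open>g\<close> with the same \<open>a\<close> and
      \<open>K\<close>.\<close>
    then show ?thesis
      by (intro exI[of _ "\<lambda>_. 0"]) (simp add: sym_brauer_char_def)
  qed
  then obtain q where "\<And>g r. sym_brauer_char p \<theta> n r g = (\<Sum>j\<le>K. a j r * q g j)" by metis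
  then have "brauer_span_dim p \<theta> n \<le> K + 1"
    unfolding brauer_span_dim_def by (intro cfun_dim_le[where a = a and c = "\<lambda>j g. q g j"])
  then show ?thesis by (simp add: K_def)
qed

theorem corollary12:
  fixes p n :: nat and \<theta> :: "'k::field alg_closure \<Rightarrow> complex"
  assumes "prime p" and "CHAR('k) = p" and "brauer_lift p \<theta>" and "n \<ge> 1"
  shows "real (brauer_span_dim p \<theta> n)
           \<le> real p / (2 * real p + 2) * (real n)\<^sup>2 + real n * log (real p) (real n) + 1"
proof -
  \<comment> \<open>Every coprime part is at least 1, so subtracting \<open>n\<close> is not
    truncated and carries over to the reals.\<close>
  have "n = (\<Sum>m=1..n. 1)" by simp
  also have "\<dots> \<le> (\<Sum>m=1..n. coprime_part p m)"
    using coprime_part_pos[OF assms(1)] by (intro sum_mono) (auto simp: Suc_le_eq)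
  finally have "real (brauer_span_dim p \<theta> n) \<le> real (\<Sum>m=1..n. coprime_part p m) - real n + 1"
    using brauer_span_dim_le[OF assms(1-3), of n] by linarith
  also have "\<dots> \<le> real p / (2 * real p + 2) * (real n)\<^sup>2 + real n * log (real p) (real n) + 1"
    using sum_coprime_part_bound[OF assms(1,4)] by simp
  finally show ?thesis .
qed

end
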